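(* In the secretary problem with advice from a binary classifier (setting in the context), with recall $p$ and specificity $p'$, $p,p'\in[\tfrac12,1]$, the optimal policy is a threshold policy.
   Context: Binary classifier setting: $n$ secretaries arrive; their ranks $(r_1,\dots,r_n)$ form a uniformly random permutation of $\{1,\dots,n\}$ (rank $n$ is best). Each secretary $i$ comes with a signal $s_i\in\{Y,N\}$, drawn independently given the ranks, with $\Pr[s_i=Y\mid r_i=n]=p$, $\Pr[s_i=N\mid r_i=n]=1-p$, and for $r<n$, $\Pr[s_i=Y\mid r_i=r]=1-p'$, $\Pr[s_i=N\mid r_i=r]=p'$. At time $i$ the algorithm observes the relative order of secretaries $1,\dots,i$ and the signals $s_1,\dots,s_i$, and irrevocably decides whether to select secretary $i$; it wins if it selects the secretary of rank $n$. The best-so-far event $T_i$ is that secretary $i$ beats all earlier ones. A threshold policy is given by $t:\{Y,N\}\to\{1,\dots,n\}$ and stops at $\tau=\min\{i: T_i \text{ occurs and } i\ge t(s_i)\}$. An optimal policy maximizes the winning probability among all (possibly randomized) policies. *)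

theory Defs
  imports "HOL-Probability.Probability"
begin

datatype signal = Y | N

definition signal_pmf :: "nat \<Rightarrow> real \<Rightarrow> real \<Rightarrow> nat \<Rightarrow> signal pmf" where
  "signal_pmf n p p' k =
     map_pmf (\<lambda>b. if b then Y else N) (bernoulli_pmf (if k = n then p else 1 - p'))"

text \<open>An instance is a pair of the rank function (a uniformly random permutation of
  \<open>{1..n}\<close>, rank \<open>n\<close> being the best) and the signals, which are independent given the ranks.
  The value \<open>N\<close> outside \<open>{1..n}\<close> is a dummy.\<close>

definition secretary_pmf :: "nat \<Rightarrow> real \<Rightarrow> real \<Rightarrow> ((nat \<Rightarrow> nat) \<times> (nat \<Rightarrow> signal)) pmf" where
  "secretary_pmf n p p' =
     bind_pmf (pmf_of_set {r. r permutes {1..n}}) (\<lambda>r.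
       map_pmf (\<lambda>s. (r, s)) (Pi_pmf {1..n} N (\<lambda>i. signal_pmf n p p' (r i))))"

text \<open>At time \<open>i\<close> the algorithm sees the relative order of the secretaries \<open>1, \<dots>, i\<close>, as a
  strict order relation, and the list of their signals. The time itself is the length of this list.\<close>

type_synonym observation = "(nat \<times> nat) set \<times> signal list"

definition observe :: "(nat \<Rightarrow> nat) \<Rightarrow> (nat \<Rightarrow> signal) \<Rightarrow> nat \<Rightarrow> observation" where
  "observe r s i = ({(j, k). j \<in> {1..i} \<and> k \<in> {1..i} \<and> r j < r k}, map s [1..<Suc i])"

text \<open>A deterministic policy says for each observation whether to select the current secretary.
  A randomized policy is a deterministic policy drawn at random, independently of the instance.
  Only finitely many observations can occur for a given \<open>n\<close>, so discrete distributions
  lose no generality; the decisions at different times may be correlated.\<close>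

type_synonym policy = "observation \<Rightarrow> bool"

definition selected :: "nat \<Rightarrow> policy \<Rightarrow> (nat \<Rightarrow> nat) \<Rightarrow> (nat \<Rightarrow> signal) \<Rightarrow> nat option" where
  "selected n d r s =
     (if \<exists>i\<in>{1..n}. d (observe r s i)
      then Some (LEAST i. i \<in> {1..n} \<and> d (observe r s i)) else None)"

definition wins :: "nat \<Rightarrow> policy \<Rightarrow> (nat \<Rightarrow> nat) \<Rightarrow> (nat \<Rightarrow> signal) \<Rightarrow> bool" where
  "wins n d r s \<longleftrightarrow> (\<exists>i. selected n d r s = Some i \<and> r i = n)"

definition win_prob :: "nat \<Rightarrow> real \<Rightarrow> real \<Rightarrow> policy pmf \<Rightarrow> real" where
  "win_prob n p p' D =
     measure_pmf.prob (pair_pmf D (secretary_pmf n p p')) {(d, r, s). wins n d r s}"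

definition optimal_policy :: "nat \<Rightarrow> real \<Rightarrow> real \<Rightarrow> policy pmf \<Rightarrow> bool" where
  "optimal_policy n p p' D \<longleftrightarrow> (\<forall>D'. win_prob n p p' D' \<le> win_prob n p p' D)"

definition best_so_far :: "(nat \<Rightarrow> nat) \<Rightarrow> nat \<Rightarrow> bool" where
  "best_so_far r i \<longleftrightarrow> (\<forall>j\<in>{1..<i}. r j < r i)"

definition threshold_policy :: "(signal \<Rightarrow> nat) \<Rightarrow> policy" where
  "threshold_policy t = (\<lambda>(R, ss).
     let i = length ss in (\<forall>j\<in>{1..<i}. (j, i) \<in> R) \<and> t (last ss) \<le> i)"

lemma threshold_policy_observe:
  assumes "1 \<le> i"
  shows "threshold_policy t (observe r s i) \<longleftrightarrow> best_so_far r i \<and> t (s i) \<le> i"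
  using assms by (auto simp: threshold_policy_def observe_def best_so_far_def Let_def)

end

theory Submission imports Defs begin

text \<open>Condition on the best secretary coming after time \<open>k\<close>: then all signals so far are noise,
  the relative order so far is uniform, and the future is independent of the past. Hence past
  signals do not affect the value of continuing. Let \<open>U k\<close> be the largest probability of winning by
  a selection after time \<open>k\<close>. If the secretary at time \<open>i\<close> is best so far with signal \<open>x\<close>, selecting is
  right iff \<open>q x / n \<ge> g x * U i / i\<close>, where \<open>q\<close> is the signal law of the best secretary and \<open>g\<close>
  that of the others. Since \<open>U\<close> is decreasing, the right-hand side decreases in \<open>i\<close>, so for each
  signal the times at which selecting is right form a final segment; it contains \<open>n\<close> because
  \<open>U n = 0\<close>. Optimality is verified by the potential \<open>U k\<close> times the noise-law probability of not
  having stopped by time \<open>k\<close>: its decrease bounds the probability of winning at time \<open>k + 1\<close>,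
  with equality for the threshold policy.\<close>

subsection \<open>Relative order of a uniformly random permutation\<close>

text \<open>Quantifying over all functions keeps this free of \<open>n\<close>, so one
  \<open>f\<close> can be averaged over permutations of \<open>{1..n}\<close> and of
  \<open>{1..k}\<close> alike.\<close>

definition order_invariant :: "nat set \<Rightarrow> ((nat \<Rightarrow> nat) \<Rightarrow> 'a) \<Rightarrow> bool" where
  "order_invariant I f \<longleftrightarrow>
     (\<forall>r r'. (\<forall>a\<in>I. \<forall>b\<in>I. r a < r b \<longleftrightarrow> r' a < r' b) \<longrightarrow> f r = f r')"

lemma order_invariantD:
  assumes "order_invariant I f" "\<And>a b. a \<in> I \<Longrightarrow> b \<in> I \<Longrightarrow> r a < r b \<longleftrightarrow> r' a < r' b"
  shows "f r = f r'"
  using assms unfolding order_invariant_def by blast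

lemma order_invariant_mono:
  "order_invariant I f \<Longrightarrow> I \<subseteq> J \<Longrightarrow> order_invariant J f"
  unfolding order_invariant_def by blast

definition raise_to_top :: "nat \<Rightarrow> nat \<Rightarrow> nat \<Rightarrow> nat" where
  "raise_to_top n v x = (if x = v then n else if v < x \<and> x \<le> n then x - 1 else x)"

lemma raise_to_top_permutes:
  assumes "v \<in> {1..n}"
  shows "raise_to_top n v permutes {1..n}"
proof (rule bij_imp_permutes)
  have "inj_on (raise_to_top n v) {1..n}"
    using assms by (auto simp: inj_on_def raise_to_top_def split: if_splits)
  moreover have "raise_to_top n v ` {1..n} \<subseteq> {1..n}"
    using assms by (auto simp: raise_to_top_def)
  ultimately show "bij_betw (raise_to_top n v) {1..n} {1..n}"
    by (simp add: bij_betw_def endo_inj_surj)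
qed (use assms in \<open>auto simp: raise_to_top_def\<close>)

lemma raise_to_top_less_iff:
  assumes "x \<in> {1..n}" "y \<in> {1..n}" "x \<noteq> v" "y \<noteq> v"
  shows "raise_to_top n v x < raise_to_top n v y \<longleftrightarrow> x < y"
  using assms by (auto simp: raise_to_top_def)

text \<open>Moving the value \<open>v\<close> to the top and closing the gap keeps the relative order of all other
  positions, so the position of the best is independent of that order.\<close>

lemma sum_permutations_fixed_value:
  fixes f :: "(nat \<Rightarrow> nat) \<Rightarrow> real"
  assumes i: "i \<in> {1..n}" and v: "v \<in> {1..n}" and inv: "order_invariant ({1..n} - {i}) f"
  shows "(\<Sum>r | r permutes {1..n} \<and> r i = v. f r) = (\<Sum>r | r permutes {1..n} \<and> r i = n. f r)"
proof -
  let ?c = "raise_to_top n v"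
  note c = raise_to_top_permutes[OF v]
  have c_v: "?c v = n" by (simp add: raise_to_top_def)
  then have inv_c_n: "inv ?c n = v" using permutes_inverses(2)[OF c] by metis
  have f_c: "f (?c \<circ> r) = f r" if r: "r permutes {1..n}" "r i = v" for r
  proof (rule order_invariantD[OF inv])
    fix a b assume ab: "a \<in> {1..n} - {i}" "b \<in> {1..n} - {i}"
    have "r a \<in> {1..n}" "r b \<in> {1..n}"
      using ab permutes_in_image[OF r(1)] by blast+
    moreover have "r a \<noteq> v" "r b \<noteq> v"
      using ab r permutes_inj[OF r(1)] by (auto dest: injD)
    ultimately show "(?c \<circ> r) a < (?c \<circ> r) b \<longleftrightarrow> r a < r b"
      using raise_to_top_less_iff by simp
  qed
  show ?thesis
  proof (rule sum.reindex_bij_witness[where i = "\<lambda>r. inv ?c \<circ> r" and j = "\<lambda>r. ?c \<circ> r"])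
    show "inv ?c \<circ> (?c \<circ> r) = r" "?c \<circ> (inv ?c \<circ> r) = r" for r
      by (simp_all add: fun_eq_iff permutes_inverses[OF c])
  qed (use c permutes_inv[OF c] c_v inv_c_n f_c in \<open>auto intro!: permutes_compose\<close>)
qed

text \<open>The classes of permutations with a given value at \<open>i\<close> all contribute
  equally, and there are \<open>n\<close> of them.\<close>

lemma sum_permutations_best_at:
  fixes f :: "(nat \<Rightarrow> nat) \<Rightarrow> real"
  assumes i: "i \<in> {1..n}" and inv: "order_invariant ({1..n} - {i}) f"
  shows "(\<Sum>r | r permutes {1..n}. f r) = n * (\<Sum>r | r permutes {1..n} \<and> r i = n. f r)"
proof -
  have range: "(\<lambda>r. r i) ` {r. r permutes {1..n}} \<subseteq> {1..n}"
    using i by (auto simp del: atLeastAtMost_iff simp: permutes_in_image)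
  have "(\<Sum>r | r permutes {1..n}. f r)
      = (\<Sum>v\<in>{1..n}. \<Sum>r\<in>{r \<in> {r. r permutes {1..n}}. r i = v}. f r)"
    using sum.group[OF _ _ range, of f] finite_permutations[of "{1..n}"] by simp
  also have "\<dots> = (\<Sum>v\<in>{1..n}. \<Sum>r | r permutes {1..n} \<and> r i = n. f r)"
    by (rule sum.cong[OF refl]) (simp only: mem_Collect_eq sum_permutations_fixed_value[OF i _ inv])
  finally show ?thesis by simp
qed

text \<open>A permutation of a set is the identity outside it, so the two sets are literally
  equal.\<close>

lemma permutes_fixing_Suc:
  "{r. r permutes {1..Suc m} \<and> r (Suc m) = Suc m} = {r. r permutes {1..m}}"
proof (rule set_eqI, rule iffI)
  fix r :: "nat \<Rightarrow> nat"
  assume "r \<in> {r. r permutes {1..Suc m} \<and> r (Suc m) = Suc m}"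
  then have r: "r permutes {1..Suc m}" "r (Suc m) = Suc m" by simp_all
  from r(1) have "r permutes {1..m}"
    by (rule permutes_superset) (use r(2) in \<open>auto simp: le_Suc_eq\<close>)
  then show "r \<in> {r. r permutes {1..m}}" by simp
next
  fix r :: "nat \<Rightarrow> nat"
  assume "r \<in> {r. r permutes {1..m}}"
  then have r: "r permutes {1..m}" by simp
  have "r permutes {1..Suc m}" using r by (rule permutes_subset) auto
  moreover have "r (Suc m) = Suc m" using r by (rule permutes_not_in) auto
  ultimately show "r \<in> {r. r permutes {1..Suc m} \<and> r (Suc m) = Suc m}" by simp
qed

text \<open>Positions are dropped from the end one at a time: \<open>f\<close> does not see the last
  one, so its value may be fixed to the maximum at the cost of a factor
  \<open>Suc ?m\<close>.\<close>

lemma sum_permutations_prefix: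
  fixes f :: "(nat \<Rightarrow> nat) \<Rightarrow> real"
  assumes "k \<le> n" and inv: "order_invariant {1..k} f"
  shows "(\<Sum>r | r permutes {1..n}. f r) / fact n = (\<Sum>r | r permutes {1..k}. f r) / fact k"
proof -
  have *: "(\<Sum>r | r permutes {1..k + l}. f r) / fact (k + l) = (\<Sum>r | r permutes {1..k}. f r) / fact k" for l
  proof (induction l)
    case 0
    show ?case by simp
  next
    case (Suc l)
    let ?m = "k + l"
    have "order_invariant ({1..Suc ?m} - {Suc ?m}) f"
      by (rule order_invariant_mono[OF inv]) auto
    then have "(\<Sum>r | r permutes {1..Suc ?m}. f r) = Suc ?m * (\<Sum>r | r permutes {1..?m}. f r)"
      using sum_permutations_best_at[of "Suc ?m" "Suc ?m" f] unfolding permutes_fixing_Suc by simp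
    then have "(\<Sum>r | r permutes {1..Suc ?m}. f r) / fact (Suc ?m)
        = (\<Sum>r | r permutes {1..?m}. f r) / fact ?m"
      by (simp only: fact_Suc) (simp del: of_nat_Suc)
    then show ?case using Suc.IH by simp
  qed
  show ?thesis using *[of "n - k"] assms(1) by simp
qed

lemma best_so_far_permutes_iff:
  assumes r: "r permutes {1..k}" and k: "1 \<le> k"
  shows "best_so_far r k \<longleftrightarrow> r k = k"
proof
  assume b: "best_so_far r k"
  obtain j where j: "j \<in> {1..k}" "r j = k"
    using permutes_image[OF r] k by (metis atLeastAtMost_iff imageE order_refl)
  have "j = k"
  proof (rule ccontr)
    assume "j \<noteq> k"
    then have "j \<in> {1..<k}" using j by auto
    then have "r j < r k" using b by (simp add: best_so_far_def)
    moreover have "r k \<le> k" using permutes_in_image[OF r, of k] k by simp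
    ultimately show False using j by simp
  qed
  then show "r k = k" using j by simp
next
  assume e: "r k = k"
  have "r j < r k" if "j \<in> {1..<k}" for j
  proof -
    have "r j \<le> k" using permutes_in_image[OF r, of j] that by simp
    moreover have "r j \<noteq> r k" using permutes_inj[OF r] that by (auto dest: injD)
    ultimately show ?thesis using e by simp
  qed
  then show "best_so_far r k" by (simp add: best_so_far_def)
qed

text \<open>After passing to permutations of \<open>{1..Suc k}\<close>, being best so far means
  having the top value, whose position is independent of the order of the others.\<close>

lemma sum_permutations_best_so_far:
  fixes f :: "(nat \<Rightarrow> nat) \<Rightarrow> real"
  assumes k: "Suc k \<le> n" and inv: "order_invariant {1..k} f"
  shows "(\<Sum>r | r permutes {1..n}. f r * of_bool (best_so_far r (Suc k)))
       = (\<Sum>r | r permutes {1..n}. f r) / Suc k"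
proof -
  let ?k = "Suc k"
  have inv': "order_invariant {1..?k} f"
    by (rule order_invariant_mono[OF inv]) auto
  have invT: "order_invariant {1..?k} (\<lambda>r. f r * of_bool (best_so_far r ?k))"
    unfolding order_invariant_def
  proof (intro allI impI)
    fix r r' :: "nat \<Rightarrow> nat"
    assume *: "\<forall>a\<in>{1..?k}. \<forall>b\<in>{1..?k}. r a < r b \<longleftrightarrow> r' a < r' b"
    then have "f r = f r'" using inv' unfolding order_invariant_def by blast
    moreover have "best_so_far r ?k = best_so_far r' ?k" using * by (simp add: best_so_far_def)
    ultimately show "f r * of_bool (best_so_far r ?k) = f r' * of_bool (best_so_far r' ?k)" by simp
  qed
  have "(\<Sum>r | r permutes {1..n}. f r * of_bool (best_so_far r ?k)) / fact n
      = (\<Sum>r | r permutes {1..?k}. f r * of_bool (best_so_far r ?k)) / fact ?k"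
    by (rule sum_permutations_prefix[OF k invT])
  also have "(\<Sum>r | r permutes {1..?k}. f r * of_bool (best_so_far r ?k))
      = (\<Sum>r | r permutes {1..?k}. f r * of_bool (r ?k = ?k))"
    by (intro sum.cong refl) (simp add: best_so_far_permutes_iff)
  also have "\<dots> = (\<Sum>r | r permutes {1..?k} \<and> r ?k = ?k. f r)"
    by (rule sum.mono_neutral_cong_right) (auto simp: finite_permutations)
  also have "\<dots> = (\<Sum>r | r permutes {1..?k}. f r) / ?k"
    by (subst sum_permutations_best_at[where i = ?k])
      (auto intro: order_invariant_mono[OF inv])
  also have "\<dots> / fact ?k = (\<Sum>r | r permutes {1..n}. f r) / fact n / ?k"
    using sum_permutations_prefix[OF k inv'] by (simp add: divide_simps)
  finally show ?thesis by (simp add: divide_simps del: of_nat_Suc fact_Suc)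
qed

subsection \<open>Independence of the signals\<close>

lemma finite_UNIV_signal: "finite (UNIV :: signal set)"
proof -
  have "(UNIV :: signal set) = {Y, N}" using signal.exhaust by auto
  then show ?thesis by (metis finite.emptyI finite.insertI)
qed

lemma finite_set_Pi_pmf_signal:
  fixes w :: "'a \<Rightarrow> signal pmf"
  assumes "finite A"
  shows "finite (set_pmf (Pi_pmf A a w))"
proof (rule finite_subset)
  show "set_pmf (Pi_pmf A a w) \<subseteq> PiE_dflt A a (set_pmf \<circ> w)"
    using assms by (rule set_Pi_pmf_subset')
  show "finite (PiE_dflt A a (set_pmf \<circ> w))"
    using assms finite_subset[OF subset_UNIV finite_UNIV_signal] by (intro finite_PiE_dflt) auto
qed

lemma expectation_Pi_pmf_prefix:
  fixes f :: "(nat \<Rightarrow> 'a) \<Rightarrow> real"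
  assumes "k \<le> n" and "\<And>s s'. (\<And>j. j \<in> {1..k} \<Longrightarrow> s j = s' j) \<Longrightarrow> f s = f s'"
  shows "measure_pmf.expectation (Pi_pmf {1..n} a w) f = measure_pmf.expectation (Pi_pmf {1..k} a w) f"
proof -
  have "Pi_pmf {1..k} a w = map_pmf (\<lambda>s x. if x \<in> {1..k} then s x else a) (Pi_pmf {1..n} a w)"
    using assms(1) by (intro Pi_pmf_subset) auto
  then have "measure_pmf.expectation (Pi_pmf {1..k} a w) f
    = measure_pmf.expectation (Pi_pmf {1..n} a w) (\<lambda>s. f (\<lambda>x. if x \<in> {1..k} then s x else a))"
    by simp
  also have "(\<lambda>s. f (\<lambda>x. if x \<in> {1..k} then s x else a)) = f"
    by (intro ext assms(2)) simp
  finally show ?thesis by simp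
qed

text \<open>The two laws need agree only up to time \<open>k\<close>. This lets the past be averaged
  under pure noise even when \<open>w (Suc k)\<close> is the signal law of the best.\<close>

lemma expectation_Pi_pmf_next:
  fixes f :: "(nat \<Rightarrow> signal) \<Rightarrow> real"
  assumes k: "k < n" and f: "\<And>s s'. (\<And>j. j \<in> {1..k} \<Longrightarrow> s j = s' j) \<Longrightarrow> f s = f s'"
    and w: "\<And>j. j \<in> {1..k} \<Longrightarrow> w j = w' j"
  shows "measure_pmf.expectation (Pi_pmf {1..n} N w) (\<lambda>s. f s * of_bool (s (Suc k) = x))
       = pmf (w (Suc k)) x * measure_pmf.expectation (Pi_pmf {1..n} N w') f"
proof -
  let ?P = "Pi_pmf {1..k} N w"
  have "measure_pmf.expectation (Pi_pmf {1..n} N w) (\<lambda>s. f s * of_bool (s (Suc k) = x))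
     = measure_pmf.expectation (Pi_pmf {1..Suc k} N w) (\<lambda>s. f s * of_bool (s (Suc k) = x))"
  proof (rule expectation_Pi_pmf_prefix)
    fix s s' :: "nat \<Rightarrow> signal" assume "\<And>j. j \<in> {1..Suc k} \<Longrightarrow> s j = s' j"
    moreover from this have "f s = f s'" by (intro f) auto
    ultimately show "f s * of_bool (s (Suc k) = x) = f s' * of_bool (s' (Suc k) = x)" by simp
  qed (use k in auto)
  also have "{1..Suc k} = insert (Suc k) {1..k}" by auto
  also have "Pi_pmf (insert (Suc k) {1..k}) N w = bind_pmf (w (Suc k)) (\<lambda>y. map_pmf (\<lambda>s. s(Suc k := y)) ?P)"
    by (subst Pi_pmf_insert') (auto simp: map_pmf_def)
  also have "measure_pmf.expectation \<dots> (\<lambda>s. f s * of_bool (s (Suc k) = x))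
     = (\<Sum>y\<in>UNIV. pmf (w (Suc k)) y * measure_pmf.expectation ?P (\<lambda>s. f (s(Suc k := y)) * of_bool (y = x)))"
    by (subst pmf_expectation_bind[where A = UNIV]) (auto simp: finite_UNIV_signal finite_set_Pi_pmf_signal)
  also have "\<dots> = (\<Sum>y\<in>UNIV. pmf (w (Suc k)) y * measure_pmf.expectation ?P f * of_bool (y = x))"
  proof (intro sum.cong refl)
    fix y
    have "f (s(Suc k := y)) = f s" for s by (intro f) auto
    then show "pmf (w (Suc k)) y * measure_pmf.expectation ?P (\<lambda>s. f (s(Suc k := y)) * of_bool (y = x))
        = pmf (w (Suc k)) y * measure_pmf.expectation ?P f * of_bool (y = x)" by simp
  qed
  also have "\<dots> = pmf (w (Suc k)) x * measure_pmf.expectation ?P f"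
    by (subst sum.remove[OF finite_UNIV_signal, of x]) (auto intro!: sum.neutral)
  also have "?P = Pi_pmf {1..k} N w'" by (intro Pi_pmf_cong) (auto simp: w)
  also have "measure_pmf.expectation \<dots> f = measure_pmf.expectation (Pi_pmf {1..n} N w') f"
    using k by (intro expectation_Pi_pmf_prefix[symmetric] f) auto
  finally show ?thesis .
qed

text \<open>A signal law for each rank, so that the true law and the auxiliary one with noise at
  every rank, \<open>\<lambda>_. V\<close>, are cases of one construction.\<close>

definition instance_pmf :: "nat \<Rightarrow> (nat \<Rightarrow> signal pmf) \<Rightarrow> ((nat \<Rightarrow> nat) \<times> (nat \<Rightarrow> signal)) pmf" where
  "instance_pmf n W =
     bind_pmf (pmf_of_set {r. r permutes {1..n}}) (\<lambda>r.
       map_pmf (\<lambda>s. (r, s)) (Pi_pmf {1..n} N (\<lambda>i. W (r i))))"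

lemma secretary_pmf_eq_instance_pmf:
  "secretary_pmf n p p' = instance_pmf n (signal_pmf n p p')"
  by (simp add: secretary_pmf_def instance_pmf_def)

lemma permutes_nonempty: "{r. r permutes A} \<noteq> {}"
  using permutes_id by blast

lemma finite_set_instance_pmf: "finite (set_pmf (instance_pmf n W))"
proof -
  have "finite (set_pmf (pmf_of_set {r. r permutes {1..n}}))"
    by (simp add: set_pmf_of_set permutes_nonempty finite_permutations del: One_nat_def Collect_empty_eq)
  then show ?thesis
    by (auto simp: instance_pmf_def finite_set_Pi_pmf_signal simp del: One_nat_def)
qed

lemma integrable_instance_pmf:
  fixes f :: "_ \<Rightarrow> real"
  shows "integrable (measure_pmf (instance_pmf n W)) f"
  by (rule integrable_measure_pmf_finite[OF finite_set_instance_pmf])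

lemma expectation_instance_pmf:
  fixes f :: "_ \<Rightarrow> real"
  shows "measure_pmf.expectation (instance_pmf n W) f =
    (\<Sum>r | r permutes {1..n}. measure_pmf.expectation (Pi_pmf {1..n} N (\<lambda>i. W (r i))) (\<lambda>s. f (r, s))) / fact n"
proof -
  have "card {r. r permutes {1..n}} = fact n"
    by (rule card_permutations) auto
  then show ?thesis
    unfolding instance_pmf_def
    by (subst pmf_expectation_bind_pmf_of_set[OF permutes_nonempty])
      (simp_all add: finite_permutations finite_set_Pi_pmf_signal sum_distrib_left divide_inverse
        mult.commute del: One_nat_def)
qed

text \<open>With the signals averaged out, what remains depends on \<open>r\<close> only through the
  order of the first \<open>k\<close>, so the permutation lemmas apply to it.\<close>

definition noise_mean :: "nat \<Rightarrow> signal pmf \<Rightarrow> (observation \<Rightarrow> real) \<Rightarrow> nat \<Rightarrow> (nat \<Rightarrow> nat) \<Rightarrow> real" where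
  "noise_mean n V F k r =
     measure_pmf.expectation (Pi_pmf {1..n} N (\<lambda>_. V)) (\<lambda>s. F (observe r s k))"

lemma order_invariant_noise_mean: "order_invariant {1..k} (noise_mean n V F k)"
  unfolding order_invariant_def
proof (rule allI, rule allI, rule impI)
  fix r r' :: "nat \<Rightarrow> nat"
  assume "\<forall>a\<in>{1..k}. \<forall>b\<in>{1..k}. (r a < r b) = (r' a < r' b)"
  then have "observe r s k = observe r' s k" for s
    by (auto simp: observe_def)
  then show "noise_mean n V F k r = noise_mean n V F k r'" by (simp add: noise_mean_def)
qed

lemma expectation_next_signal:
  assumes k: "k < n" and w: "\<And>j. j \<in> {1..k} \<Longrightarrow> w j = V"
  shows "measure_pmf.expectation (Pi_pmf {1..n} N w) (\<lambda>s. F (observe r s k) * of_bool (s (Suc k) = x))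
       = pmf (w (Suc k)) x * noise_mean n V F k r"
  unfolding noise_mean_def
proof (rule expectation_Pi_pmf_next[OF k _ w])
  fix s s' :: "nat \<Rightarrow> signal" assume "\<And>j. j \<in> {1..k} \<Longrightarrow> s j = s' j"
  then have "observe r s k = observe r s' k" by (auto simp: observe_def simp del: upt_Suc)
  then show "F (observe r s k) = F (observe r s' k)" by simp
qed

lemma expectation_noise_mean:
  "measure_pmf.expectation (instance_pmf n (\<lambda>_. V)) (\<lambda>(r, s). F (observe r s k))
     = (\<Sum>r | r permutes {1..n}. noise_mean n V F k r) / fact n"
  by (simp add: expectation_instance_pmf noise_mean_def)

text \<open>If the best comes at \<open>Suc k\<close>, everyone earlier emits noise, while the
  current signal has law \<open>W n\<close>. The factor \<open>1 / n\<close> arises because the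
  position of the best is independent of the order of the others.\<close>

lemma expectation_best_next:
  fixes F :: "observation \<Rightarrow> real"
  assumes k: "k < n" and W: "\<And>v. v \<noteq> n \<Longrightarrow> W v = V"
  shows "measure_pmf.expectation (instance_pmf n W)
      (\<lambda>(r, s). F (observe r s k) * of_bool (s (Suc k) = x) * of_bool (r (Suc k) = n))
    = pmf (W n) x / n *
      measure_pmf.expectation (instance_pmf n (\<lambda>_. V)) (\<lambda>(r, s). F (observe r s k))"
proof -
  let ?\<phi> = "noise_mean n V F k"
  have inv: "order_invariant ({1..n} - {Suc k}) ?\<phi>"
    by (rule order_invariant_mono[OF order_invariant_noise_mean]) (use k in auto)
  have *: "measure_pmf.expectation (Pi_pmf {1..n} N (\<lambda>i. W (r i)))
        (\<lambda>s. F (observe r s k) * of_bool (s (Suc k) = x) * of_bool (r (Suc k) = n))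
      = pmf (W n) x * (?\<phi> r * of_bool (r (Suc k) = n))" if r: "r permutes {1..n}" for r
  proof (cases "r (Suc k) = n")
    case True
    have "W (r j) = V" if "j \<in> {1..k}" for j
    proof -
      have "r j \<noteq> r (Suc k)" using permutes_inj[OF r] that by (simp add: inj_eq)
      then show ?thesis using True W by simp
    qed
    then show ?thesis using True expectation_next_signal[OF k, of "\<lambda>i. W (r i)" V] by simp
  qed simp
  have "measure_pmf.expectation (instance_pmf n W)
      (\<lambda>(r, s). F (observe r s k) * of_bool (s (Suc k) = x) * of_bool (r (Suc k) = n))
    = (\<Sum>r | r permutes {1..n}. pmf (W n) x * (?\<phi> r * of_bool (r (Suc k) = n))) / fact n"
    unfolding expectation_instance_pmf prod.case
    by (rule arg_cong[where f = "\<lambda>x. x / fact n"], rule sum.cong[OF refl]) (simp only: mem_Collect_eq *)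
  also have "(\<Sum>r | r permutes {1..n}. pmf (W n) x * (?\<phi> r * of_bool (r (Suc k) = n)))
    = pmf (W n) x * (\<Sum>r | r permutes {1..n}. ?\<phi> r * of_bool (r (Suc k) = n))"
    by (rule sum_distrib_left[symmetric])
  also have "(\<Sum>r | r permutes {1..n}. ?\<phi> r * of_bool (r (Suc k) = n))
      = (\<Sum>r | r permutes {1..n} \<and> r (Suc k) = n. ?\<phi> r)"
    by (rule sum.mono_neutral_cong_right) (auto simp: finite_permutations)
  also have "\<dots> = (\<Sum>r | r permutes {1..n}. ?\<phi> r) / n"
    using sum_permutations_best_at[OF _ inv] k by simp
  finally show ?thesis unfolding expectation_noise_mean by simp
qed

text \<open>With noise at every rank, signals are independent of ranks, so the next signal and being
  best so far contribute separate factors.\<close>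

lemma expectation_best_so_far_next:
  fixes F :: "observation \<Rightarrow> real"
  assumes k: "k < n"
  shows "measure_pmf.expectation (instance_pmf n (\<lambda>_. V))
      (\<lambda>(r, s). F (observe r s k) * of_bool (s (Suc k) = x) * of_bool (best_so_far r (Suc k)))
    = pmf V x / Suc k *
      measure_pmf.expectation (instance_pmf n (\<lambda>_. V)) (\<lambda>(r, s). F (observe r s k))"
proof -
  let ?\<phi> = "noise_mean n V F k"
  have "measure_pmf.expectation (instance_pmf n (\<lambda>_. V))
      (\<lambda>(r, s). F (observe r s k) * of_bool (s (Suc k) = x) * of_bool (best_so_far r (Suc k)))
    = (\<Sum>r | r permutes {1..n}. pmf V x * (?\<phi> r * of_bool (best_so_far r (Suc k)))) / fact n"
    by (simp add: expectation_instance_pmf expectation_next_signal[OF k] mult.assoc[symmetric] del: One_nat_def)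
  also have "(\<Sum>r | r permutes {1..n}. pmf V x * (?\<phi> r * of_bool (best_so_far r (Suc k))))
    = pmf V x * (\<Sum>r | r permutes {1..n}. ?\<phi> r * of_bool (best_so_far r (Suc k)))"
    by (simp add: sum_distrib_left)
  also have "(\<Sum>r | r permutes {1..n}. ?\<phi> r * of_bool (best_so_far r (Suc k)))
      = (\<Sum>r | r permutes {1..n}. ?\<phi> r) / Suc k"
    using k by (intro sum_permutations_best_so_far order_invariant_noise_mean) auto
  finally show ?thesis unfolding expectation_noise_mean by simp
qed

section \<open>Observations as records of the history\<close>

definition extend :: "observation \<Rightarrow> signal \<Rightarrow> observation" where
  "extend h x = (case h of (R, ss) \<Rightarrow> (R \<union> {1..length ss} \<times> {Suc (length ss)}, ss @ [x]))"

text \<open>A newcomer who beats everyone has a forced place in the order. The decision about it is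
  thus a function of the observation at time \<open>k\<close> and the new signal.\<close>

lemma observe_Suc_best_so_far:
  assumes "best_so_far r (Suc k)"
  shows "observe r s (Suc k) = extend (observe r s k) (s (Suc k))"
proof -
  have less: "r j < r (Suc k)" "\<not> r (Suc k) < r j" if "1 \<le> j" "j \<le> k" for j
  proof -
    show "r j < r (Suc k)" using assms that by (simp add: best_so_far_def)
    then show "\<not> r (Suc k) < r j" by simp
  qed
  have "{(a, b). a \<in> {1..Suc k} \<and> b \<in> {1..Suc k} \<and> r a < r b}
      = {(a, b). a \<in> {1..k} \<and> b \<in> {1..k} \<and> r a < r b} \<union> {1..k} \<times> {Suc k}"
    using less by (auto simp: le_Suc_eq)
  then show ?thesis by (simp add: observe_def extend_def)
qed

text \<open>An observation determines all earlier ones, so having passed on everyone so far is a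
  property of the current observation alone.\<close>

definition truncate :: "nat \<Rightarrow> observation \<Rightarrow> observation" where
  "truncate j h = (case h of (R, ss) \<Rightarrow> (R \<inter> {1..j} \<times> {1..j}, take j ss))"

lemma truncate_observe: "j \<le> k \<Longrightarrow> truncate j (observe r s k) = observe r s j"
  by (auto simp: truncate_def observe_def take_map take_upt simp del: upt_Suc)

definition passed :: "policy \<Rightarrow> observation \<Rightarrow> bool" where
  "passed d h \<longleftrightarrow> (\<forall>j\<in>{1..length (snd h)}. \<not> d (truncate j h))"

lemma passed_observe: "passed d (observe r s k) \<longleftrightarrow> (\<forall>j\<in>{1..k}. \<not> d (observe r s j))"
proof -
  have "length (snd (observe r s k)) = k" by (simp add: observe_def)
  then show ?thesis by (auto simp: passed_def truncate_observe)
qed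

lemma passed_observe_Suc:
  "passed d (observe r s (Suc k)) \<longleftrightarrow> passed d (observe r s k) \<and> \<not> d (observe r s (Suc k))"
  unfolding passed_observe by (auto simp: atLeastAtMostSuc_conv)

subsection \<open>Stopping under the noise law\<close>

lemma set_instance_pmf_permutes:
  assumes "(r, s) \<in> set_pmf (instance_pmf n W)"
  shows "r permutes {1..n}"
proof -
  have "set_pmf (pmf_of_set {r. r permutes {1..n}}) = {r. r permutes {1..n}}"
    by (rule set_pmf_of_set[OF permutes_nonempty]) (simp add: finite_permutations)
  then show ?thesis using assms by (auto simp: instance_pmf_def simp del: One_nat_def)
qed

lemma permutes_best_so_far:
  assumes "r permutes {1..n}" "r i = n"
  shows "best_so_far r i"
  unfolding best_so_far_def
proof (rule ballI)
  fix j assume j: "j \<in> {1..<i}"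
  have "i \<le> n"
  proof (rule ccontr)
    assume "\<not> i \<le> n"
    then have "r i = i" using assms(1) by (intro permutes_not_in) auto
    then show False using assms(2) \<open>\<not> i \<le> n\<close> by simp
  qed
  then have "r j \<le> n" using permutes_in_image[OF assms(1), of j] j by simp
  moreover have "r j \<noteq> r i" using permutes_inj[OF assms(1)] j by (simp add: inj_eq)
  ultimately show "r j < r i" using assms(2) by simp
qed

text \<open>Winning is split by the time \<open>Suc k\<close> of the first selection; at most one
  summand is nonzero.\<close>

lemma of_bool_wins:
  "of_bool (wins n d r s) = (\<Sum>k<n. of_bool (passed d (observe r s k) \<and> d (observe r s (Suc k)) \<and> r (Suc k) = n) :: real)"
proof (cases "\<exists>i\<in>{1..n}. d (observe r s i)")
  case False
  then have "\<not> d (observe r s (Suc k))" if "k < n" for k using that by auto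
  moreover have "\<not> wins n d r s" using False by (auto simp: wins_def selected_def)
  ultimately show ?thesis by simp
next
  case True
  define i where "i = (LEAST i. i \<in> {1..n} \<and> d (observe r s i))"
  have i: "i \<in> {1..n} \<and> d (observe r s i)"
    unfolding i_def by (rule LeastI_ex) (use True in blast)
  have before: "\<not> d (observe r s j)" if "j \<in> {1..n}" "j < i" for j
    using not_less_Least[of j "\<lambda>i. i \<in> {1..n} \<and> d (observe r s i)"] that by (auto simp: i_def)
  obtain m where m: "i = Suc m" using i by (cases i) auto
  have first: "passed d (observe r s k) \<and> d (observe r s (Suc k)) \<longleftrightarrow> k = m" if "k < n" for k
  proof
    assume *: "passed d (observe r s k) \<and> d (observe r s (Suc k))"
    then have "\<not> Suc k < i" using before[of "Suc k"] that by auto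
    moreover have "\<not> i \<le> k" using * i by (auto simp: passed_observe)
    ultimately show "k = m" using m by simp
  next
    assume "k = m"
    then show "passed d (observe r s k) \<and> d (observe r s (Suc k))"
      using before i m by (auto simp: passed_observe)
  qed
  have "wins n d r s \<longleftrightarrow> r i = n"
    using True by (simp add: wins_def selected_def i_def)
  moreover have "(\<Sum>k<n. of_bool (passed d (observe r s k) \<and> d (observe r s (Suc k)) \<and> r (Suc k) = n) :: real)
      = (\<Sum>k<n. if k = m then of_bool (r i = n) else 0)"
    using first m by (intro sum.cong refl) auto
  ultimately show ?thesis using i m by simp
qed

text \<open>Both masses are taken under the law where even the best secretary emits a noise signal. This is
  the law of the history conditioned on the best secretary being still to come.\<close>

definition pass_mass :: "nat \<Rightarrow> signal pmf \<Rightarrow> policy \<Rightarrow> nat \<Rightarrow> real" where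
  "pass_mass n V d k = measure_pmf.expectation (instance_pmf n (\<lambda>_. V))
     (\<lambda>(r, s). of_bool (passed d (observe r s k)))"

definition stop_mass :: "nat \<Rightarrow> signal pmf \<Rightarrow> policy \<Rightarrow> nat \<Rightarrow> signal \<Rightarrow> real" where
  "stop_mass n V d k x = measure_pmf.expectation (instance_pmf n (\<lambda>_. V))
     (\<lambda>(r, s). of_bool (passed d (observe r s k) \<and> d (extend (observe r s k) x)))"

lemma pass_mass_0: "pass_mass n V d 0 = 1"
  by (simp add: pass_mass_def passed_observe case_prod_unfold)

lemma stop_mass_nonneg: "0 \<le> stop_mass n V d k x"
  unfolding stop_mass_def by (rule integral_nonneg_AE) auto

lemma stop_mass_le: "stop_mass n V d k x \<le> pass_mass n V d k"
  unfolding stop_mass_def pass_mass_def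
  by (rule integral_mono[OF integrable_instance_pmf integrable_instance_pmf]) auto

lemma expectation_instance_pmf_cong:
  fixes f g :: "_ \<Rightarrow> real"
  assumes "\<And>r s. r permutes {1..n} \<Longrightarrow> f (r, s) = g (r, s)"
  shows "measure_pmf.expectation (instance_pmf n W) f = measure_pmf.expectation (instance_pmf n W) g"
  using assms set_instance_pmf_permutes
  by (intro integral_cong_AE) (auto simp: AE_measure_pmf_iff simp del: One_nat_def)

text \<open>A winning selection hits a best so far secretary, so the observation there is an
  \<open>extend\<close>; splitting by its signal reduces the claim to
  \<open>expectation_best_next\<close>.\<close>

lemma win_at_eq:
  assumes k: "k < n" and W: "\<And>v. v \<noteq> n \<Longrightarrow> W v = V"
  shows "measure_pmf.expectation (instance_pmf n W)
      (\<lambda>(r, s). of_bool (passed d (observe r s k) \<and> d (observe r s (Suc k)) \<and> r (Suc k) = n))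
    = (\<Sum>x\<in>{Y, N}. pmf (W n) x / n * stop_mass n V d k x)"
proof -
  define F :: "signal \<Rightarrow> observation \<Rightarrow> real" where "F x h = of_bool (passed d h \<and> d (extend h x))" for x h
  have stop: "stop_mass n V d k x = measure_pmf.expectation (instance_pmf n (\<lambda>_. V)) (\<lambda>(r, s). F x (observe r s k))" for x
    by (simp add: stop_mass_def F_def)
  have "measure_pmf.expectation (instance_pmf n W)
      (\<lambda>(r, s). of_bool (passed d (observe r s k) \<and> d (observe r s (Suc k)) \<and> r (Suc k) = n))
    = measure_pmf.expectation (instance_pmf n W)
      (\<lambda>m. \<Sum>x\<in>{Y, N}. (\<lambda>(r, s). F x (observe r s k) * of_bool (s (Suc k) = x) * of_bool (r (Suc k) = n)) m)"
  \<comment> \<open>The identity is used pointwise on permutations, where holding rank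
    \<open>n\<close> implies being best so far.\<close>
  proof (rule expectation_instance_pmf_cong)
    fix r :: "nat \<Rightarrow> nat" and s :: "nat \<Rightarrow> signal"
    assume r: "r permutes {1..n}"
    show "(case (r, s) of (r, s) \<Rightarrow> of_bool (passed d (observe r s k) \<and> d (observe r s (Suc k)) \<and> r (Suc k) = n))
      = (\<Sum>x\<in>{Y, N}. case (r, s) of (r, s) \<Rightarrow> F x (observe r s k) * of_bool (s (Suc k) = x) * of_bool (r (Suc k) = n))"
      using observe_Suc_best_so_far[OF permutes_best_so_far[OF r], of k s]
      by (cases "s (Suc k)") (auto simp: F_def)
  qed
  also have "\<dots> = (\<Sum>x\<in>{Y, N}. pmf (W n) x / n * stop_mass n V d k x)"
    unfolding Bochner_Integration.integral_sum[OF integrable_instance_pmf] stop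
    by (rule sum.cong[OF refl], rule expectation_best_next) (use k W in auto)
  finally show ?thesis .
qed

lemma sum_signal: "(\<Sum>x\<in>{Y, N}. f x) = f Y + f N"
  by simp

text \<open>Only stops at a best so far secretary are subtracted. Stops elsewhere can only lower the
  remaining mass further; if there are none, the bound is exact.\<close>

lemma
  assumes k: "k < n"
  shows pass_mass_Suc_le:
      "pass_mass n V d (Suc k) \<le> pass_mass n V d k - (\<Sum>x\<in>{Y, N}. pmf V x / Suc k * stop_mass n V d k x)"
    and pass_mass_Suc_eq:
      "(\<And>r s. d (observe r s (Suc k)) \<Longrightarrow> best_so_far r (Suc k)) \<Longrightarrow>
       pass_mass n V d (Suc k) = pass_mass n V d k - (\<Sum>x\<in>{Y, N}. pmf V x / Suc k * stop_mass n V d k x)"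
proof -
  define F :: "signal \<Rightarrow> observation \<Rightarrow> real" where "F x h = of_bool (passed d h \<and> d (extend h x))" for x h
  have stop: "stop_mass n V d k x = measure_pmf.expectation (instance_pmf n (\<lambda>_. V)) (\<lambda>(r, s). F x (observe r s k))" for x
    by (simp add: stop_mass_def F_def)
  \<comment> \<open>\<open>B\<close> indicates not having stopped by \<open>Suc k\<close>, where a
    stop at \<open>Suc k\<close> itself is ignored unless that secretary is best so far.\<close>
  define B :: "(nat \<Rightarrow> nat) \<times> (nat \<Rightarrow> signal) \<Rightarrow> real" where
    "B m = (\<lambda>(r, s). of_bool (passed d (observe r s k))) m
      - (\<Sum>x\<in>{Y, N}. (\<lambda>(r, s). F x (observe r s k) * of_bool (s (Suc k) = x) * of_bool (best_so_far r (Suc k))) m)" for m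
  have eB: "measure_pmf.expectation (instance_pmf n (\<lambda>_. V)) B
      = pass_mass n V d k - (\<Sum>x\<in>{Y, N}. pmf V x / Suc k * stop_mass n V d k x)"
    unfolding B_def
    unfolding Bochner_Integration.integral_diff[OF integrable_instance_pmf integrable_instance_pmf]
      Bochner_Integration.integral_sum[OF integrable_instance_pmf] stop pass_mass_def
    by (rule arg_cong2[where f = minus, OF refl], rule sum.cong[OF refl], rule expectation_best_so_far_next[OF k])
  have T: "of_bool (passed d (observe r s (Suc k))) = B (r, s)" if "best_so_far r (Suc k)" for r s
    unfolding B_def sum_signal prod.case F_def passed_observe_Suc
    using observe_Suc_best_so_far[OF that, of s] that by (cases "s (Suc k)") auto
  have T': "B (r, s) = of_bool (passed d (observe r s k))" if "\<not> best_so_far r (Suc k)" for r s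
    using that by (simp add: B_def)
  have le: "of_bool (passed d (observe r s (Suc k))) \<le> B (r, s)" for r s
    using T[of r s] T'[of r s] by (cases "best_so_far r (Suc k)") (auto simp: passed_observe_Suc)
  show "pass_mass n V d (Suc k) \<le> pass_mass n V d k - (\<Sum>x\<in>{Y, N}. pmf V x / Suc k * stop_mass n V d k x)"
    unfolding eB[symmetric] unfolding pass_mass_def
    by (rule integral_mono[OF integrable_instance_pmf integrable_instance_pmf])
      (use le in \<open>auto simp del: of_bool_eq\<close>)
  assume d: "\<And>r s. d (observe r s (Suc k)) \<Longrightarrow> best_so_far r (Suc k)"
  have "of_bool (passed d (observe r s (Suc k))) = B (r, s)" for r s
    using T[of r s] T'[of r s] d[of r s] by (cases "best_so_far r (Suc k)") (auto simp: passed_observe_Suc)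
  then show "pass_mass n V d (Suc k) = pass_mass n V d k - (\<Sum>x\<in>{Y, N}. pmf V x / Suc k * stop_mass n V d k x)"
    unfolding eB[symmetric] unfolding pass_mass_def by (intro arg_cong2[of _ _ _ _ lebesgue_integral] refl) auto
qed

subsection \<open>The dynamic program\<close>

text \<open>Backward induction, indexed by the number of secretaries left. With \<open>Suc m\<close>
  left the next decision is at time \<open>n - m\<close>; \<open>max 0\<close> chooses between
  selecting and passing for each signal.\<close>

primrec remaining_value :: "nat \<Rightarrow> (signal \<Rightarrow> real) \<Rightarrow> (signal \<Rightarrow> real) \<Rightarrow> nat \<Rightarrow> real" where
  "remaining_value n q g 0 = 0"
| "remaining_value n q g (Suc m) = remaining_value n q g m +
     (\<Sum>x\<in>{Y, N}. max 0 (q x / n - g x * remaining_value n q g m / (n - m)))"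

text \<open>The probability (not conditioned on the best being still to come) that an optimal policy wins
  if it may select only after time \<open>k\<close>. Its monotonicity in \<open>k\<close> is what forces thresholds.\<close>

definition value_after :: "nat \<Rightarrow> (signal \<Rightarrow> real) \<Rightarrow> (signal \<Rightarrow> real) \<Rightarrow> nat \<Rightarrow> real" where
  "value_after n q g k = remaining_value n q g (n - k)"

text \<open>The net benefit, per unit of \<open>stop_mass\<close>, of selecting a best so far
  secretary: under noise it has signal \<open>x\<close> at time \<open>i\<close> with probability
  \<open>g x / i\<close>, and selecting forfeits \<open>value_after\<close> on that mass.\<close>

definition stop_gain :: "nat \<Rightarrow> (signal \<Rightarrow> real) \<Rightarrow> (signal \<Rightarrow> real) \<Rightarrow> nat \<Rightarrow> signal \<Rightarrow> real" where
  "stop_gain n q g i x = q x / n - g x * value_after n q g i / i"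

lemma value_after_end: "value_after n q g n = 0"
  by (simp add: value_after_def)

lemma value_after_step:
  assumes "k < n"
  shows "value_after n q g k = value_after n q g (Suc k) + (\<Sum>x\<in>{Y, N}. max 0 (stop_gain n q g (Suc k) x))"
proof -
  have "n - k = Suc (n - Suc k)" "real n - real (n - Suc k) = real (Suc k)" using assms by auto
  then show ?thesis by (simp add: value_after_def stop_gain_def del: of_nat_Suc)
qed

lemma value_after_antimono:
  assumes "k \<le> l" "l \<le> n"
  shows "value_after n q g l \<le> value_after n q g k"
  using assms
proof (induction l rule: nat_induct_at_least)
  case (Suc l)
  then have "value_after n q g (Suc l) \<le> value_after n q g l"
    by (subst (2) value_after_step) auto
  then show ?case using Suc by simp
qed simp

lemma value_after_nonneg: "k \<le> n \<Longrightarrow> 0 \<le> value_after n q g k"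
  using value_after_antimono[of k n n q g] by (simp add: value_after_end)

lemma stop_gain_nonneg_mono:
  assumes "1 \<le> i" "i \<le> j" "j \<le> n" "0 \<le> g x" "0 \<le> stop_gain n q g i x"
  shows "0 \<le> stop_gain n q g j x"
proof -
  have "g x * value_after n q g j / j \<le> g x * value_after n q g i / i"
    using assms value_after_antimono[of i j n q g] value_after_nonneg[of j n q g]
    by (intro frac_le mult_left_mono mult_nonneg_nonneg) auto
  then show ?thesis using assms(5) by (simp add: stop_gain_def)
qed

section \<open>Optimality by the potential\<close>

locale classified_instance =
  fixes n :: nat and W :: "nat \<Rightarrow> signal pmf" and V :: "signal pmf"
  assumes n_pos: "1 \<le> n" and W_noise: "v \<noteq> n \<Longrightarrow> W v = V"
begin

abbreviation "val \<equiv> value_after n (pmf (W n)) (pmf V)"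
abbreviation "gain \<equiv> stop_gain n (pmf (W n)) (pmf V)"

definition win_at :: "policy \<Rightarrow> nat \<Rightarrow> real" where
  "win_at d k = (\<Sum>x\<in>{Y, N}. pmf (W n) x / n * stop_mass n V d k x)"

lemma prob_wins_eq: "measure_pmf.prob (instance_pmf n W) {(r, s). wins n d r s} = (\<Sum>k<n. win_at d k)"
proof -
  have "measure_pmf.prob (instance_pmf n W) {(r, s). wins n d r s}
      = measure_pmf.expectation (instance_pmf n W) (indicator {(r, s). wins n d r s})"
    by simp
  also have "indicator {(r, s). wins n d r s} = (\<lambda>m. \<Sum>k<n. (\<lambda>(r, s). of_bool (passed d (observe r s k)
      \<and> d (observe r s (Suc k)) \<and> r (Suc k) = n) :: real) m)"
    by (rule ext) (auto simp: indicator_def of_bool_wins[symmetric])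
  also have "measure_pmf.expectation (instance_pmf n W) \<dots> = (\<Sum>k<n. win_at d k)"
    unfolding Bochner_Integration.integral_sum[OF integrable_instance_pmf]
    unfolding win_at_def by (rule sum.cong[OF refl], rule win_at_eq) (use W_noise in auto)
  finally show ?thesis .
qed

text \<open>Inserting the bound on \<open>pass_mass\<close> at \<open>Suc k\<close> makes
  \<open>gain\<close> the coefficient of \<open>stop_mass\<close>. As \<open>stop_mass\<close> lies
  between 0 and \<open>?G\<close>, nothing beats taking all of \<open>?G\<close> where the gain is
  positive, and \<open>value_after_step\<close> pays exactly for that.\<close>

lemma win_at_le:
  assumes "k < n"
  shows "win_at d k + val (Suc k) * pass_mass n V d (Suc k) \<le> val k * pass_mass n V d k"
proof -
  let ?G = "pass_mass n V d k"
  have "val (Suc k) * pass_mass n V d (Suc k)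
      \<le> val (Suc k) * (?G - (\<Sum>x\<in>{Y, N}. pmf V x / Suc k * stop_mass n V d k x))"
    using assms by (intro mult_left_mono pass_mass_Suc_le value_after_nonneg) auto
  then have "win_at d k + val (Suc k) * pass_mass n V d (Suc k)
      \<le> val (Suc k) * ?G + (\<Sum>x\<in>{Y, N}. gain (Suc k) x * stop_mass n V d k x)"
    by (simp add: win_at_def stop_gain_def algebra_simps)
  also have "(\<Sum>x\<in>{Y, N}. gain (Suc k) x * stop_mass n V d k x) \<le> (\<Sum>x\<in>{Y, N}. max 0 (gain (Suc k) x) * ?G)"
    by (intro sum_mono mult_mono stop_mass_le stop_mass_nonneg) auto
  finally show ?thesis
    unfolding value_after_step[OF assms] by (simp add: algebra_simps)
qed

lemma sum_win_at_le:
  assumes "m \<le> n"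
  shows "(\<Sum>k<m. win_at d k) + val m * pass_mass n V d m \<le> val 0"
  using assms
proof (induction m)
  case 0
  show ?case by (simp add: pass_mass_0)
next
  case (Suc m)
  then show ?case using win_at_le[of m d] by simp
qed

lemma prob_wins_le: "measure_pmf.prob (instance_pmf n W) {(r, s). wins n d r s} \<le> val 0"
  using sum_win_at_le[of n d] by (simp add: prob_wins_eq value_after_end)

text \<open>The condition \<open>1 \<le> i\<close> matters: at \<open>i = 0\<close> division by zero
  makes the gain nonnegative, and the least index would be 0.\<close>

definition threshold :: "signal \<Rightarrow> nat" where
  "threshold x = (LEAST i. 1 \<le> i \<and> 0 \<le> gain i x)"

lemma gain_end_nonneg: "0 \<le> gain n x"
  by (simp add: stop_gain_def value_after_end)

lemma threshold_props: "1 \<le> threshold x" "0 \<le> gain (threshold x) x" "threshold x \<le> n"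
proof -
  have end_ok: "1 \<le> n \<and> 0 \<le> gain n x" using n_pos gain_end_nonneg by blast
  show "1 \<le> threshold x" "0 \<le> gain (threshold x) x"
    using LeastI[of "\<lambda>i. 1 \<le> i \<and> 0 \<le> gain i x", OF end_ok] by (auto simp: threshold_def)
  show "threshold x \<le> n"
    unfolding threshold_def using end_ok by (rule Least_le)
qed

lemma threshold_le_iff:
  assumes "1 \<le> i" "i \<le> n"
  shows "threshold x \<le> i \<longleftrightarrow> 0 \<le> gain i x"
proof
  assume "threshold x \<le> i"
  then show "0 \<le> gain i x"
    using stop_gain_nonneg_mono[of "threshold x" i n "pmf V" x] threshold_props assms by simp
next
  assume "0 \<le> gain i x"
  then show "threshold x \<le> i"
    unfolding threshold_def using assms by (intro Least_le) simp
qed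

text \<open>\<open>extend\<close> already places the newcomer above all earlier ones, so only the
  test on time remains, and it ignores the past.\<close>

lemma threshold_policy_extend:
  "threshold_policy t (extend (observe r s k) x) \<longleftrightarrow> t x \<le> Suc k"
  by (auto simp: threshold_policy_def extend_def observe_def Let_def)

lemma stop_mass_threshold:
  "stop_mass n V (threshold_policy t) k x = of_bool (t x \<le> Suc k) * pass_mass n V (threshold_policy t) k"
  by (simp add: stop_mass_def pass_mass_def threshold_policy_extend case_prod_unfold)

text \<open>Both inequalities behind \<open>win_at_le\<close> are tight here: this policy stops only
  at best so far secretaries, and \<open>stop_mass\<close> is all of \<open>?G\<close> or 0
  according to the sign of the gain.\<close>

lemma win_at_threshold:
  assumes "k < n"
  defines "d \<equiv> threshold_policy threshold"
  shows "win_at d k + val (Suc k) * pass_mass n V d (Suc k) = val k * pass_mass n V d k"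
proof -
  let ?G = "pass_mass n V d k"
  have G: "pass_mass n V d (Suc k) = ?G - (\<Sum>x\<in>{Y, N}. pmf V x / Suc k * stop_mass n V d k x)"
    by (rule pass_mass_Suc_eq[OF assms(1)]) (simp add: d_def threshold_policy_observe)
  have "win_at d k + val (Suc k) * pass_mass n V d (Suc k)
      = val (Suc k) * ?G + (\<Sum>x\<in>{Y, N}. gain (Suc k) x * stop_mass n V d k x)"
    unfolding G by (simp add: win_at_def stop_gain_def algebra_simps)
  also have "(\<Sum>x\<in>{Y, N}. gain (Suc k) x * stop_mass n V d k x) = (\<Sum>x\<in>{Y, N}. max 0 (gain (Suc k) x) * ?G)"
  proof (rule sum.cong[OF refl])
    show "gain (Suc k) x * stop_mass n V d k x = max 0 (gain (Suc k) x) * ?G" for x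
      using threshold_le_iff[of "Suc k" x] assms(1) by (simp add: d_def stop_mass_threshold max_def)
  qed
  finally show ?thesis
    unfolding value_after_step[OF assms(1)] by (simp add: algebra_simps)
qed

lemma prob_wins_threshold:
  "measure_pmf.prob (instance_pmf n W) {(r, s). wins n (threshold_policy threshold) r s} = val 0"
proof -
  have "m \<le> n \<Longrightarrow> (\<Sum>k<m. win_at (threshold_policy threshold) k)
      + val m * pass_mass n V (threshold_policy threshold) m = val 0" for m
  proof (induction m)
    case 0
    show ?case by (simp add: pass_mass_0)
  next
    case (Suc m)
    then show ?case using win_at_threshold[of m] by simp
  qed
  from this[of n] show ?thesis by (simp add: prob_wins_eq value_after_end)
qed

end

section \<open>Randomized policies\<close>

lemma win_prob_return_pmf:
  "win_prob n p p' (return_pmf d) = measure_pmf.prob (secretary_pmf n p p') {(r, s). wins n d r s}"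
  by (simp add: win_prob_def pair_return_pmf1 vimage_def case_prod_unfold)

text \<open>By Tonelli, the winning probability of \<open>D\<close> is an average over the
  deterministic policies it draws.\<close>

lemma win_prob_le:
  assumes "0 \<le> c" "\<And>d. measure_pmf.prob (secretary_pmf n p p') {(r, s). wins n d r s} \<le> c"
  shows "win_prob n p p' D \<le> c"
proof -
  let ?M = "secretary_pmf n p p'" and ?A = "{(d, r, s). wins n d r s}"
  have "emeasure (pair_pmf D ?M) ?A = (\<integral>\<^sup>+z. indicator ?A z \<partial>pair_pmf D ?M)"
    by simp
  also have "\<dots> = (\<integral>\<^sup>+d. \<integral>\<^sup>+m. indicator ?A (d, m) \<partial>?M \<partial>D)"
    by (rule nn_integral_pair_pmf')
  also have "\<dots> = (\<integral>\<^sup>+d. \<integral>\<^sup>+m. indicator {(r, s). wins n d r s} m \<partial>?M \<partial>D)"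
    by (intro nn_integral_cong) (auto simp: indicator_def)
  also have "\<dots> = (\<integral>\<^sup>+d. emeasure ?M {(r, s). wins n d r s} \<partial>D)"
    by simp
  also have "\<dots> \<le> (\<integral>\<^sup>+d. ennreal c \<partial>D)"
    using assms by (intro nn_integral_mono) (simp add: measure_pmf.emeasure_eq_measure ennreal_leI)
  also have "\<dots> = ennreal c" by simp
  finally show ?thesis
    using assms(1) by (simp add: win_prob_def measure_pmf.emeasure_eq_measure)
qed

theorem theorem4:
  fixes n :: nat and p p' :: real
  assumes "1 \<le> n"
    and "p \<in> {1/2..1}" and "p' \<in> {1/2..1}"
  shows "\<exists>t :: signal \<Rightarrow> nat. (\<forall>x. t x \<in> {1..n}) \<and>
           optimal_policy n p p' (return_pmf (threshold_policy t))"
proof -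
  \<comment> \<open>Rank 0 stands for any rank other than \<open>n\<close>: since
    \<open>1 \<le> n\<close>, it gets the signal law of a secretary who is not the best.\<close>
  interpret classified_instance n "signal_pmf n p p'" "signal_pmf n p p' 0"
    by unfold_locales (use assms(1) in \<open>auto simp: signal_pmf_def\<close>)
  have "win_prob n p p' D \<le> win_prob n p p' (return_pmf (threshold_policy threshold))" for D
    unfolding win_prob_return_pmf secretary_pmf_eq_instance_pmf prob_wins_threshold
    by (rule win_prob_le) (simp_all add: value_after_nonneg secretary_pmf_eq_instance_pmf prob_wins_le)
  then show ?thesis
    using threshold_props by (intro exI[of _ threshold]) (simp add: optimal_policy_def)
qed

end
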